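(* Let $\alpha>1$, $a>0$, and let $(\lambda_k)_{k\ge1}$ be a sequence of positive real numbers. Assume that $\gamma>0$ and $\Gamma_1<+\infty$, where $$\gamma=\inf_{k\ne n}|\lambda_k-\lambda_n|,\qquad \Gamma_1=\sup_{k\ge1}\frac{|\lambda_k-ak^\alpha|}{k^{\alpha-1}}.$$ Let $m>0$, $0<T<m$ and $u\in L^1(0,T)$. Define, for $z\in\mathbb C$, $$\mathcal G(z)=\int_0^T u(t)e^{-izt}\,dt.$$ Assume that $\mathcal G(-\lambda_1)=1$ and $\mathcal G(-\lambda_k)=0$ for all $k\ge2$. Then $$\|u\|_{L^1(0,T)}\ge c\,T^{C}e^{\frac{\rho}{T^\tau}}\quad\text{with }\tau=\frac1{\alpha-1},$$ for some positive constants $c,C$ depending only on $\alpha,a,\gamma,\Gamma_1$, and $m$. Here $$\rho=2^{\frac1\beta}\,\beta\left(\frac{\theta_\alpha}{a^{1/\alpha}(1+\beta)}\right)^{1+\frac1\beta}\quad\text{with }\beta=\alpha-1.$$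
   Context: The function $u$ is complex-valued. For $\alpha>1$, $$\theta_\alpha=-\int_0^\infty\ln\left(\frac{x^\alpha}{\sqrt{x^{2\alpha}+1}}\right)dx=\frac12\int_0^\infty\ln(1+x^{-2\alpha})\,dx=\frac{\pi}{2\sin(\pi/(2\alpha))}.$$ *)

theory Defs
  imports "HOL-Analysis.Analysis"
begin

text \<open>Sequences \<open>(\<lambda>\<^sub>k)\<close> with \<open>k \<ge> 1\<close> are functions on \<^typ>\<open>nat\<close> whose value at \<open>0\<close> is never
  consulted.\<close>

definition gap :: "(nat \<Rightarrow> real) \<Rightarrow> real" where
  "gap lam = (INF (k, n) \<in> {(k, n). 1 \<le> k \<and> 1 \<le> n \<and> k \<noteq> n}. \<bar>lam k - lam n\<bar>)"

text \<open>Taken in \<^typ>\<open>ereal\<close>, so that \<open>dev \<alpha> a lam = ereal G\<close> includes finiteness of the supremum.\<close>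

definition dev :: "real \<Rightarrow> real \<Rightarrow> (nat \<Rightarrow> real) \<Rightarrow> ereal" where
  "dev \<alpha> a lam =
     (SUP k\<in>{1..}. ereal (\<bar>lam k - a * real k powr \<alpha>\<bar> / real k powr (\<alpha> - 1)))"

definition \<theta> :: "real \<Rightarrow> real" where
  "\<theta> \<alpha> = - (LINT x:{0<..}|lebesgue. ln (x powr \<alpha> / sqrt (x powr (2 * \<alpha>) + 1)))"

definition \<rho> :: "real \<Rightarrow> real \<Rightarrow> real" where
  "\<rho> \<alpha> a = (let \<beta> = \<alpha> - 1 in
     2 powr (1 / \<beta>) * \<beta> * (\<theta> \<alpha> / (a powr (1 / \<alpha>) * (1 + \<beta>))) powr (1 + 1 / \<beta>))"

definition \<G> :: "real \<Rightarrow> (real \<Rightarrow> complex) \<Rightarrow> complex \<Rightarrow> complex" where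
  "\<G> T u z = (LINT t:{0<..<T}|lebesgue. u t * exp (- \<i> * z * complex_of_real t))"

definition L1_norm :: "real \<Rightarrow> (real \<Rightarrow> complex) \<Rightarrow> real" where
  "L1_norm T u = (LINT t:{0<..<T}|lebesgue. norm (u t))"

end

theory Submission
  imports Defs "HOL-Complex_Analysis.Complex_Analysis" "HOL-Real_Asymp.Real_Asymp"
begin

text \<open>
  Centred at \<open>- lam 1\<close> and multiplied by \<open>exp (\<i> z T / 2)\<close>, the function \<open>\<G>\<close> takes the value \<open>1\<close> at
  the origin, vanishes at the points \<open>lam 1 - lam k\<close>, and is bounded by
  \<open>\<parallel>u\<parallel> exp (T \<bar>Im z\<bar> / 2)\<close>. As \<open>\<bar>Im z\<bar>\<close> has mean \<open>2 R / \<pi>\<close> on the circle of radius \<open>R\<close>, Jensen's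
  inequality yields \<open>ln \<parallel>u\<parallel> \<ge> (\<Sum>k. ln (R / \<bar>lam k - lam 1\<bar>)) - T R / \<pi>\<close>. With \<open>R = a X\<^sup>\<alpha>\<close> the right-hand
  side is \<open>\<alpha> X - T a X\<^sup>\<alpha> / \<pi> - O(ln X)\<close>, and maximising over \<open>X\<close> gives the exponent
  \<open>\<beta> * (\<pi> / (a T)) powr (1 / \<beta>)\<close> with \<open>\<beta> = \<alpha> - 1\<close>. This dominates \<open>\<rho> / T powr (1 / \<beta>)\<close> because
  \<open>\<theta> \<alpha> / \<alpha>\<close> is the moment of order \<open>1 / \<alpha>\<close> of the probability density \<open>2 w / (1 + w\<^sup>2)\<^sup>2\<close> on the
  half-line, whose mean is \<open>\<pi> / 2\<close>, so that concavity bounds it by \<open>(\<pi> / 2) powr (1 / \<alpha>)\<close>.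
\<close>

section \<open>Comparison of \<open>\<rho>\<close> with the exponent from Jensen's
  inequality\<close>

lemma \<theta>_le:
  fixes \<alpha> :: real
  assumes "\<alpha> > 1"
  shows "\<theta> \<alpha> \<le> \<alpha> * (pi / 2) powr (1 / \<alpha>)"
proof -
  define s where "s = 1 / \<alpha>"
  define A where "A = (1 - s) * (pi / 2) powr s"
  define B where "B = s * (pi / 2) powr (s - 1)"
  define w where "w = (\<lambda>x. x powr \<alpha>)"
  define f where "f = (\<lambda>x. ln (x powr (2 * \<alpha>) + 1) / 2 - \<alpha> * ln x)"
  \<comment> \<open>Two integrations by parts turn \<open>f\<close> into \<open>x = w powr s\<close> against the density above; \<open>A + B * w\<close> is the
    tangent of \<open>w powr s\<close> at the mean \<open>w = pi / 2\<close>, and \<open>F\<close> is what integrates in closed form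
    once \<open>x\<close> is replaced by it.\<close>
  define F where "F = (\<lambda>x. x * f x + \<alpha> * ((x - A) / (1 + x powr (2 * \<alpha>)) +
         B * (arctan (x powr \<alpha>) - x powr \<alpha> / (1 + x powr (2 * \<alpha>)))))"
  define g where "g = (\<lambda>x. f x + 2 * \<alpha>\<^sup>2 * (w x)\<^sup>2 / (x * (1 + (w x)\<^sup>2)\<^sup>2) * (A + B * w x - x))"
  have s: "0 < s" "s < 1" using assms by (auto simp: s_def)
  have w2: "x powr (2 * \<alpha>) = (w x)\<^sup>2" for x
    by (simp add: w_def power2_eq_square flip: powr_add)
  have f_eq: "- ln (x powr \<alpha> / sqrt (x powr (2 * \<alpha>) + 1)) = f x" if "x > 0" for x
    using that by (simp add: f_def ln_div ln_sqrt add_pos_nonneg add_nonneg_eq_0_iff)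
  have f_nonneg: "f x \<ge> 0" if "x > 0" for x
  proof -
    have "2 * \<alpha> * ln x = ln (x powr (2 * \<alpha>))" using that by (simp add: ln_powr)
    also have "\<dots> \<le> ln (x powr (2 * \<alpha>) + 1)" using that by (intro ln_mono) auto
    finally show ?thesis by (simp add: f_def)
  qed
  \<comment> \<open>Young's inequality with weights \<open>s\<close> and \<open>1 - s\<close>,
    rescaled by \<open>(pi / 2) powr (s - 1)\<close>, is the tangent-line inequality for
    \<open>w powr s\<close> at \<open>pi / 2\<close>.\<close>
  have tangent: "x \<le> A + B * w x" if "x > 0" for x
  proof -
    have "w x powr s * (pi / 2) powr (1 - s) \<le> s * w x + (1 - s) * (pi / 2)"
      using that s by (intro Youngs_inequality_0) (auto simp: w_def)
    moreover have "w x powr s = x"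
      using that assms by (simp add: w_def s_def powr_powr)
    ultimately have "x * (pi / 2) powr (1 - s) * (pi / 2) powr (s - 1)
        \<le> (s * w x + (1 - s) * (pi / 2)) * (pi / 2) powr (s - 1)"
      by (intro mult_right_mono) auto
    moreover have "(pi / 2) powr (1 - s) * (pi / 2) powr (s - 1) = 1"
      by (simp flip: powr_add)
    ultimately have "x \<le> (s * w x + (1 - s) * (pi / 2)) * (pi / 2) powr (s - 1)"
      by (simp only: mult.assoc)
    also have "\<dots> = A + B * w x"
      by (simp add: A_def B_def powr_diff field_simps)
    finally show ?thesis .
  qed
  have f_le_g: "f x \<le> g x" if "x > 0" for x
    using tangent[OF that] that by (simp add: g_def)
  have deriv: "(F has_real_derivative g x) (at x)" if "x > 0" for x
  proof -
    have dw: "(w has_real_derivative \<alpha> * w x / x) (at x)"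
      unfolding w_def using that by (auto intro!: derivative_eq_intros simp: powr_diff)
    have pos: "1 + (w x)\<^sup>2 > 0" by (simp add: add_pos_nonneg)
    define W where "W = w x"
    define V where "V = 1 + W\<^sup>2"
    have V: "V > 0" "V \<noteq> 0" using pos by (auto simp: V_def W_def)
    define l where "l = (\<lambda>x. ln (1 + (w x)\<^sup>2) / 2)"
    have "((\<lambda>x. ln (1 + (w x)\<^sup>2)) has_real_derivative 2 * (W * (\<alpha> * W / x) / V)) (at x)"
      using pos unfolding V_def W_def by (auto intro!: derivative_eq_intros dw simp: mult_ac)
    from DERIV_cdivide[OF this, of 2] have dl: "(l has_real_derivative W * (\<alpha> * W / x) / V) (at x)"
      by (simp add: l_def)
    have fx: "f x = l x - \<alpha> * ln x" for x by (simp add: f_def l_def w2 add.commute)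
    have "((\<lambda>x. x * (l x - \<alpha> * ln x) + \<alpha> * ((x - A) / (1 + (w x)\<^sup>2) +
         B * (arctan (w x) - w x / (1 + (w x)\<^sup>2)))) has_real_derivative
        (f x + x * (W * (\<alpha> * W / x) / V - \<alpha> / x)
         + \<alpha> * ((V - (x - A) * (2 * W * (\<alpha> * W / x))) / V\<^sup>2
            + B * (\<alpha> * W / x / V - (\<alpha> * W / x * V - W * (2 * W * (\<alpha> * W / x))) / V\<^sup>2)))) (at x)"
      using that pos unfolding fx
      by (auto intro!: derivative_eq_intros dw dl simp: fx V_def W_def power2_eq_square inverse_eq_divide mult_ac)
    also have "f x + x * (W * (\<alpha> * W / x) / V - \<alpha> / x)
         + \<alpha> * ((V - (x - A) * (2 * W * (\<alpha> * W / x))) / V\<^sup>2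
            + B * (\<alpha> * W / x / V - (\<alpha> * W / x * V - W * (2 * W * (\<alpha> * W / x))) / V\<^sup>2))
        = f x + (\<alpha> * (W\<^sup>2 - V) * x * V + \<alpha> * x * V - 2 * \<alpha>\<^sup>2 * (x - A) * W\<^sup>2
            + 2 * \<alpha>\<^sup>2 * B * W ^ 3) / (x * V\<^sup>2)"
      using that V by (simp add: field_simps power2_eq_square power3_eq_cube)
    also have "W\<^sup>2 - V = - 1" by (simp add: V_def)
    also have "f x + (\<alpha> * - 1 * x * V + \<alpha> * x * V - 2 * \<alpha>\<^sup>2 * (x - A) * W\<^sup>2
            + 2 * \<alpha>\<^sup>2 * B * W ^ 3) / (x * V\<^sup>2) = g x"
      unfolding g_def W_def[symmetric] V_def[symmetric]
      using that V by (simp add: field_simps power2_eq_square power3_eq_cube)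
    finally show ?thesis
      unfolding F_def fx w2 by (simp add: w_def)
  qed
  have cont: "isCont g x" if "x > 0" for x
    using that unfolding g_def f_def w_def
    by (intro continuous_intros) (auto simp: add_pos_nonneg add_nonneg_eq_0_iff)
  \<comment> \<open>\<open>x * f x\<close> vanishes at both ends: \<open>f\<close> is logarithmic at
    0 and of order \<open>x powr (- 2 * \<alpha>)\<close> at infinity. Only the constant
    \<open>- A\<close> at 0 and the arctangent at infinity survive.\<close>
  have lim0: "(F \<longlongrightarrow> - \<alpha> * A) (at_right 0)"
    unfolding F_def f_def using assms by real_asymp
  have limoo: "(F \<longlongrightarrow> \<alpha> * B * pi / 2) at_top"
    unfolding F_def f_def using assms by real_asymp
  have int_set: "einterval 0 \<infinity> = {0::real<..}"
    by (auto simp: einterval_def)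
  \<comment> \<open>Since \<open>g\<close> is nonnegative, the fundamental theorem yields its
    integrability together with its integral; \<open>f\<close> is then integrable by
    domination.\<close>
  have FTC: "set_integrable lborel {0<..} g" "(LINT x:{0<..}|lborel. g x) = \<alpha> * B * pi / 2 - - \<alpha> * A"
  proof -
    note * = interval_integral_FTC_nonneg[of "0::ereal" "\<infinity>" F g "- \<alpha> * A" "\<alpha> * B * pi / 2"]
    have prem: "((F \<circ> real_of_ereal) \<longlongrightarrow> - \<alpha> * A) (at_right (0::ereal))"
         "((F \<circ> real_of_ereal) \<longlongrightarrow> \<alpha> * B * pi / 2) (at_left \<infinity>)"
      using lim0 limoo by (simp_all add: zero_ereal_def ereal_tendsto_simps)
    have g0: "0 \<le> g x" if "x > 0" for x using f_nonneg[OF that] f_le_g[OF that] by linarith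
    show "set_integrable lborel {0<..} g"
      using *(1) prem deriv cont g0 by (simp add: int_set)
    have "(LBINT x=0..\<infinity>. g x) = \<alpha> * B * pi / 2 - - \<alpha> * A"
      using *(2) prem deriv cont g0 by simp
    then show "(LINT x:{0<..}|lborel. g x) = \<alpha> * B * pi / 2 - - \<alpha> * A"
      by (simp add: interval_lebesgue_integral_def int_set)
  qed
  have [measurable]: "f \<in> borel_measurable borel"
    unfolding f_def by measurable
  have "\<theta> \<alpha> = (LINT x:{0<..}|lebesgue. f x)"
    unfolding \<theta>_def set_lebesgue_integral_def Bochner_Integration.integral_minus[symmetric]
    by (intro Bochner_Integration.integral_cong refl) (simp add: indicator_def flip: f_eq)
  also have "\<dots> = (LINT x:{0<..}|lborel. f x)"
    unfolding set_lebesgue_integral_def by (intro integral_completion) measurable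
  also have "\<dots> \<le> (LINT x:{0<..}|lborel. g x)"
  proof (rule set_integral_mono)
    show "set_integrable lborel {0<..} f"
      using FTC(1) by (rule set_integrable_bound)
        (use f_nonneg f_le_g in \<open>auto simp: set_borel_measurable_def intro!: AE_I2 order_trans[OF f_le_g]\<close>)
  qed (use FTC f_le_g in auto)
  also have "\<dots> = \<alpha> * (B * pi / 2 + A)" by (simp add: FTC algebra_simps)
  \<comment> \<open>The tangent is evaluated at its point of contact
    \<open>w = pi / 2\<close>.\<close>
  also have "B * pi / 2 + A = (pi / 2) powr s"
    by (simp add: A_def B_def powr_diff algebra_simps)
  finally show ?thesis by (simp add: s_def)
qed

text \<open>Supplies the nonnegative base needed for raising the bound on
  \<open>\<theta> \<alpha>\<close> to a power.\<close>

lemma \<theta>_nonneg: "\<theta> \<alpha> \<ge> 0"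
proof -
  have "0 \<le> (LINT x:{0<..}|lebesgue. - ln (x powr \<alpha> / sqrt (x powr (2 * \<alpha>) + 1)))"
    unfolding set_lebesgue_integral_def
  proof (rule integral_nonneg_AE, rule AE_I2)
    fix x :: real
    have "x powr \<alpha> \<le> sqrt (x powr (2 * \<alpha>) + 1)"
      by (rule real_le_rsqrt) (simp add: power2_eq_square flip: powr_add)
    moreover have "x powr (2 * \<alpha>) + 1 > 0" by (simp add: add_nonneg_pos)
    ultimately have "x powr \<alpha> / sqrt (x powr (2 * \<alpha>) + 1) \<le> 1"
      by (simp add: divide_simps add_nonneg_eq_0_iff add_pos_nonneg)
    then show "0 \<le> indicat_real {0<..} x *\<^sub>R - ln (x powr \<alpha> / sqrt (x powr (2 * \<alpha>) + 1))"
      by (cases "x > 0") (auto intro!: ln_le_zero_iff[THEN iffD2] simp: add_pos_nonneg divide_pos_pos)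
  qed
  then show ?thesis by (simp add: \<theta>_def set_lebesgue_integral_def)
qed

text \<open>With \<open>b = 1 / (\<alpha> - 1)\<close> the outer exponent \<open>1 + b\<close>
  equals \<open>\<alpha> * b\<close>, which cancels the \<open>1 / \<alpha>\<close> in the bound on
  \<open>\<theta>\<close>; the factor \<open>2 powr b\<close> then absorbs the 2 in
  \<open>pi / (2 * a)\<close>.\<close>

lemma \<rho>_le:
  fixes \<alpha> a :: real
  assumes "\<alpha> > 1" "a > 0"
  shows "\<rho> \<alpha> a \<le> (\<alpha> - 1) * (pi / a) powr (1 / (\<alpha> - 1))"
proof -
  define b where "b = 1 / (\<alpha> - 1)"
  have b: "b > 0" "1 + b = \<alpha> * b" using assms by (auto simp: b_def field_simps)
  have "\<theta> \<alpha> / (a powr (1 / \<alpha>) * \<alpha>) \<le> (pi / 2) powr (1 / \<alpha>) / a powr (1 / \<alpha>)"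
    using \<theta>_le[OF assms(1)] assms by (simp add: field_simps)
  also have "\<dots> = (pi / (2 * a)) powr (1 / \<alpha>)"
    using assms by (simp add: powr_divide powr_mult field_simps)
  finally have "(\<theta> \<alpha> / (a powr (1 / \<alpha>) * \<alpha>)) powr (1 + b) \<le> ((pi / (2 * a)) powr (1 / \<alpha>)) powr (1 + b)"
    using assms b \<theta>_nonneg[of \<alpha>] by (intro powr_mono2) auto
  also have "\<dots> = (pi / (2 * a)) powr b"
    using assms b by (simp add: powr_powr)
  finally have "2 powr b * (\<theta> \<alpha> / (a powr (1 / \<alpha>) * \<alpha>)) powr (1 + b) \<le> 2 powr b * (pi / (2 * a)) powr b"
    by simp
  also have "\<dots> = (pi / a) powr b"
    using assms by (simp flip: powr_mult)
  finally have "(\<alpha> - 1) * (2 powr b * (\<theta> \<alpha> / (a powr (1 / \<alpha>) * \<alpha>)) powr (1 + b)) \<le> (\<alpha> - 1) * (pi / a) powr b"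
    using assms by (intro mult_left_mono) auto
  then show ?thesis
    by (simp add: \<rho>_def Let_def b_def mult_ac)
qed

section \<open>Jensen-type bounds for holomorphic functions with given zeros\<close>

lemma norm_Blaschke_numerator_eq:
  fixes z a :: complex and R :: real
  assumes "cmod z = R"
  shows "cmod (of_real (R\<^sup>2) - cnj a * z) = R * cmod (z - a)"
proof -
  have "of_real (R\<^sup>2) = z * cnj z"
    using assms by (metis complex_norm_square of_real_power)
  then have "of_real (R\<^sup>2) - cnj a * z = z * cnj (z - a)"
    by (simp add: algebra_simps)
  then show ?thesis
    using assms by (simp add: norm_mult flip: complex_cnj_diff)
qed

text \<open>Induction on the zeros: dividing one of them out keeps the bound \<open>M\<close> on the
  circle and multiplies the modulus at the origin by \<open>R / cmod a\<close>. Without zeros this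
  is the maximum modulus principle.\<close>

lemma Jensen_zeros_bound:
  fixes f :: "complex \<Rightarrow> complex" and Z :: "complex set"
  assumes "finite Z" "Z \<subseteq> ball 0 R" "R > 0" "open S" "cball 0 R \<subseteq> S" "f holomorphic_on S"
    and "\<And>z. cmod z = R \<Longrightarrow> cmod (f z) \<le> M" "\<And>z. z \<in> Z \<Longrightarrow> f z = 0" "0 \<notin> Z"
  shows "cmod (f 0) \<le> M * (\<Prod>z\<in>Z. cmod z / R)"
  using assms(1,2,6-)
proof (induction Z arbitrary: f rule: finite_induct)
  case empty
  have "cmod (f 0) \<le> M"
  proof (rule maximum_modulus_frontier[of f "cball 0 R"])
    show "f holomorphic_on interior (cball 0 R)" "continuous_on (closure (cball 0 R)) f"
      using empty.prems(2) assms(5) holomorphic_on_subset[of f S]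
      by (auto intro!: holomorphic_on_imp_continuous_on simp: subset_eq)
  qed (use \<open>R > 0\<close> empty in \<open>auto simp: dist_norm\<close>)
  then show ?case by simp
next
  case (insert a Z)
  define g where "g = (\<lambda>z. if z = a then deriv f a else (f z - f a) / (z - a))"
  \<comment> \<open>dividing by a Blaschke factor of the disc, which has modulus one on the circle\<close>
  define h where "h = (\<lambda>z. g z * (of_real (R\<^sup>2) - cnj a * z) / of_real R)"
  have a: "cmod a < R" "a \<noteq> 0" "f a = 0" using insert by auto
  have "a \<in> interior S" using a assms(4,5) by (auto simp: interior_open)
  then have "g holomorphic_on S"
    unfolding g_def using insert.prems by (intro pole_lemma)
  then have holh: "h holomorphic_on S"
    unfolding h_def using \<open>R > 0\<close> by (intro holomorphic_intros) auto
  have "cmod (h 0) \<le> M * (\<Prod>z\<in>Z. cmod z / R)"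
  proof (rule insert.IH)
    fix z assume z: "cmod z = R"
    then have "z \<noteq> a" using a by auto
    then have "cmod (h z) = cmod (f z) / cmod (z - a) * (R * cmod (z - a)) / R"
      using \<open>R > 0\<close> a unfolding h_def g_def norm_divide norm_mult norm_Blaschke_numerator_eq[OF z]
      by (simp add: norm_divide)
    also have "\<dots> = cmod (f z)" using \<open>R > 0\<close> \<open>z \<noteq> a\<close> by simp
    finally have "cmod (h z) = cmod (f z)" .
    then show "cmod (h z) \<le> M" using insert.prems z by simp
  next
    fix z assume "z \<in> Z"
    then show "h z = 0" using insert.hyps insert.prems a by (auto simp: h_def g_def)
  qed (use insert holh in auto)
  moreover have "cmod (h 0) = cmod (f 0) * R / cmod a"
    using a \<open>R > 0\<close> by (simp add: h_def g_def norm_mult norm_divide power2_eq_square)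
  ultimately have "cmod (f 0) \<le> (cmod a / R) * (M * (\<Prod>z\<in>Z. cmod z / R))"
    using a \<open>R > 0\<close> by (simp add: field_simps)
  then show ?case using insert.hyps by (simp add: mult_ac)
qed

text \<open>By oddness \<open>y\<close> may be replaced by its absolute value; then
  \<open>arctan t = pi / 2 - arctan (1 / t)\<close> for positive \<open>t\<close>, and
  \<open>arctan x \<le> x\<close> for nonnegative \<open>x\<close>. It is applied with
  \<open>s = 1 - (cmod z)\<^sup>2\<close>.\<close>

lemma arctan_mult_ge:
  fixes y s :: real
  assumes "s > 0"
  shows "y * arctan (2 * y / s) \<ge> \<bar>y\<bar> * pi / 2 - s / 2"
proof (cases "y = 0")
  case False
  have eq: "y * arctan (2 * y / s) = \<bar>y\<bar> * arctan (2 * \<bar>y\<bar> / s)"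
    by (cases "y > 0") (auto simp: abs_if arctan_minus)
  have "arctan (inverse (s / (2 * \<bar>y\<bar>))) = pi / 2 - arctan (s / (2 * \<bar>y\<bar>))"
    using assms False by (intro arctan_inverse) auto
  moreover have "arctan (s / (2 * \<bar>y\<bar>)) \<le> s / (2 * \<bar>y\<bar>)"
    using assms by (intro arctan_le_self) auto
  ultimately have "arctan (2 * \<bar>y\<bar> / s) \<ge> pi / 2 - s / (2 * \<bar>y\<bar>)" by simp
  then have "\<bar>y\<bar> * arctan (2 * \<bar>y\<bar> / s) \<ge> \<bar>y\<bar> * (pi / 2 - s / (2 * \<bar>y\<bar>))"
    by (intro mult_left_mono) auto
  then show ?thesis using False eq by (simp add: algebra_simps)
qed (use assms in simp)

text \<open>The Cayley transform maps the unit disc into the right half-plane, where the principal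
  argument is the arctangent of \<open>Im w / Re w\<close>. The last claim holds because the sign of
  \<open>Re z\<close> decides which of \<open>cmod (1 + z)\<close> and \<open>cmod (1 - z)\<close>
  is larger.\<close>

lemma Ln_Cayley_Re_Im:
  fixes z :: complex
  assumes "cmod z < 1"
  defines "w \<equiv> (1 + z) / (1 - z)"
  shows "Re w > 0" "Im (Ln w) = arctan (2 * Im z / (1 - (cmod z)\<^sup>2))" "Re z * Re (Ln w) \<ge> 0"
proof -
  have z1: "1 - z \<noteq> 0" "1 + z \<noteq> 0"
    using assms(1) by (auto simp: add_eq_0_iff)
  define d where "d = (cmod (1 - z))\<^sup>2"
  have d: "d > 0" using z1 by (simp add: d_def)
  have d_eq: "d = (1 - Re z)\<^sup>2 + (Im z)\<^sup>2" by (simp add: d_def cmod_power2)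
  have s: "1 - (cmod z)\<^sup>2 > 0" using assms(1) by (simp add: abs_square_less_1)
  have Re: "Re w = (1 - (cmod z)\<^sup>2) / d"
    by (simp add: w_def Re_divide d_eq cmod_power2) (simp add: power2_eq_square algebra_simps)
  have Im: "Im w = 2 * Im z / d"
    by (simp add: w_def Im_divide d_eq) (simp add: power2_eq_square algebra_simps)
  show "Re w > 0" using Re s d by simp
  moreover from this have "w \<noteq> 0" by auto
  ultimately show "Im (Ln w) = arctan (2 * Im z / (1 - (cmod z)\<^sup>2))"
    using arg_conv_arctan[of w] Arg_eq_Im_Ln[of w] d by (simp add: Re Im)
  have Lnw: "Re (Ln w) = ln (cmod (1 + z)) - ln (cmod (1 - z))"
    using z1 \<open>w \<noteq> 0\<close> by (simp add: w_def norm_divide ln_div)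
  have "(cmod (1 + z))\<^sup>2 - (cmod (1 - z))\<^sup>2 = 4 * Re z"
    by (simp add: cmod_power2) (simp add: power2_eq_square algebra_simps)
  then have "Re z \<ge> 0 \<Longrightarrow> (cmod (1 - z))\<^sup>2 \<le> (cmod (1 + z))\<^sup>2"
      "Re z \<le> 0 \<Longrightarrow> (cmod (1 + z))\<^sup>2 \<le> (cmod (1 - z))\<^sup>2"
    by linarith+
  then have "Re z \<ge> 0 \<Longrightarrow> cmod (1 - z) \<le> cmod (1 + z)" "Re z \<le> 0 \<Longrightarrow> cmod (1 + z) \<le> cmod (1 - z)"
    by (meson norm_ge_zero power2_le_imp_le)+
  then show "Re z * Re (Ln w) \<ge> 0"
    using z1 unfolding Lnw
    by (cases "Re z \<ge> 0") (auto intro!: mult_nonneg_nonneg mult_nonpos_nonpos)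
qed

text \<open>The function \<open>q z = (1 / z - z) * Ln ((1 + z) / (1 - z)) / pi\<close> has real part \<open>\<bar>Im z\<bar>\<close> on the unit
  circle; the error term makes the bound usable on smaller circles, where no boundary regularity
  at \<open>\<plusminus>1\<close> is needed.\<close>
lemma harmonic_majorant_abs_Im:
  "\<exists>q :: complex \<Rightarrow> complex. q holomorphic_on ball 0 1 \<and> q 0 = of_real (2 / pi) \<and>
    (\<forall>z. cmod z < 1 \<longrightarrow> Re (q z) \<ge> \<bar>Im z\<bar> - (1 - (cmod z)\<^sup>2) / pi)"
proof -
  define L where "L = (\<lambda>z. Ln ((1 + z) / (1 - z)))"
  \<comment> \<open>As \<open>L 0 = 0\<close>, this is \<open>L z / z\<close> continued
    holomorphically across the origin, with value 2 there.\<close>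
  define g where "g = (\<lambda>z. if z = 0 then deriv L 0 else (L z - L 0) / (z - 0))"
  define q where "q = (\<lambda>z. (1 - z\<^sup>2) * g z / of_real pi)"
  have nz: "1 - z \<noteq> 0" "(1 + z) / (1 - z) \<notin> \<real>\<^sub>\<le>\<^sub>0" if "cmod z < 1" for z
  proof -
    show "1 - z \<noteq> 0" using that by auto
    show "(1 + z) / (1 - z) \<notin> \<real>\<^sub>\<le>\<^sub>0"
      using Ln_Cayley_Re_Im(1)[OF that] by (auto simp: complex_nonpos_Reals_iff)
  qed
  have "L holomorphic_on ball 0 1"
    unfolding L_def using nz by (intro holomorphic_intros) auto
  then have "g holomorphic_on ball 0 1"
    unfolding g_def by (intro pole_lemma) auto
  then have hol: "q holomorphic_on ball 0 1"
    unfolding q_def by (intro holomorphic_intros) auto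
  have "(L has_field_derivative 2) (at 0)"
    unfolding L_def by (rule derivative_eq_intros refl | simp)+
  then have "deriv L 0 = 2" by (rule DERIV_imp_deriv)
  then have q0: "q 0 = of_real (2 / pi)" by (simp add: q_def g_def)
  have "Re (q z) \<ge> \<bar>Im z\<bar> - (1 - (cmod z)\<^sup>2) / pi" if z: "cmod z < 1" for z
  proof (cases "z = 0")
    case True
    have "- (1 / pi) \<le> 0" "0 \<le> 2 / pi" by simp_all
    then have "- (1 / pi) \<le> 2 / pi" by linarith
    then show ?thesis using True by (simp add: q0)
  next
    case False
    have s: "1 - (cmod z)\<^sup>2 > 0" using z by (simp add: abs_square_less_1)
    define r where "r = (cmod z)\<^sup>2"
    have r: "r > 0" "r < 1" using False s by (auto simp: r_def)
    have r_eq: "r = (Re z)\<^sup>2 + (Im z)\<^sup>2" by (simp add: r_def cmod_power2)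
    have "1 / z = cnj z / of_real r"
      using False complex_norm_square[of z] by (simp add: r_def field_simps)
    then have *: "q z = (cnj z / of_real r - z) * L z / of_real pi"
      using False by (simp add: q_def g_def L_def power2_eq_square field_simps)
    \<comment> \<open>The first summand is nonnegative and gets dropped. In the second,
      \<open>1 / r + 1\<close> is at least 2 and \<open>Im z * Im (L z)\<close> is at least
      \<open>\<bar>Im z\<bar> * pi / 2\<close> up to an error of order \<open>1 - r\<close>.\<close>
    have re: "Re (q z) = (Re z * Re (L z) * (1 / r - 1) + (1 / r + 1) * (Im z * Im (L z))) / pi"
      unfolding * by (simp add: algebra_simps Re_divide_of_real Im_divide_of_real add_divide_distrib)
    have p: "Re z * Re (L z) * (1 / r - 1) \<ge> 0"
      using Ln_Cayley_Re_Im(3)[OF z] r by (intro mult_nonneg_nonneg[of "Re z * Re (L z)"]) (auto simp: L_def)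
    have x: "Im z * Im (L z) \<ge> \<bar>Im z\<bar> * pi / 2 - (1 - r) / 2"
      using Ln_Cayley_Re_Im(2)[OF z] arctan_mult_ge[of "1 - r" "Im z"] r by (simp add: L_def r_def)
    have y: "(1 / r + 1) * (Im z * Im (L z)) \<ge> 2 * (Im z * Im (L z))"
    proof (rule mult_right_mono)
      show "0 \<le> Im z * Im (L z)"
        using Ln_Cayley_Re_Im(2)[OF z] s
        by (auto simp: L_def zero_le_mult_iff divide_simps)
    qed (use r in auto)
    have "2 * (\<bar>Im z\<bar> * pi / 2 - (1 - r) / 2) \<le> 2 * (Im z * Im (L z))"
      using x by (intro mult_left_mono) auto
    also note y
    also have "(1 / r + 1) * (Im z * Im (L z)) \<le>
        Re z * Re (L z) * (1 / r - 1) + (1 / r + 1) * (Im z * Im (L z))"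
      using p by (intro add_increasing) simp_all
    finally have "Re (q z) \<ge> (2 * (\<bar>Im z\<bar> * pi / 2 - (1 - r) / 2)) / pi"
      unfolding re by (rule divide_right_mono) simp
    then show ?thesis by (simp add: r_def diff_divide_distrib)
  qed
  with hol q0 show ?thesis by blast
qed

text \<open>Dividing \<open>f\<close> by the exponential of a holomorphic function with real part at
  least \<open>\<sigma> * \<bar>Im z\<bar>\<close> on the circle reduces to the bounded case, at the
  cost of that function's value at the origin.\<close>

lemma Jensen_exponential_type:
  fixes f :: "complex \<Rightarrow> complex" and Z :: "complex set" and \<sigma> M :: real
  assumes "f holomorphic_on UNIV" "\<And>z. cmod (f z) \<le> M * exp (\<sigma> * \<bar>Im z\<bar>)" "\<sigma> \<ge> 0"
    and "finite Z" "Z \<subseteq> ball 0 R" "R > 0" "\<And>z. z \<in> Z \<Longrightarrow> f z = 0" "0 \<notin> Z"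
  shows "cmod (f 0) \<le> M * exp (2 * \<sigma> * R / pi) * (\<Prod>z\<in>Z. cmod z / R)"
proof -
  obtain q :: "complex \<Rightarrow> complex" where q: "q holomorphic_on ball 0 1" "q 0 = of_real (2 / pi)"
    "\<And>z. cmod z < 1 \<Longrightarrow> Re (q z) \<ge> \<bar>Im z\<bar> - (1 - (cmod z)\<^sup>2) / pi"
    using harmonic_majorant_abs_Im by blast
  define P where "P = (\<Prod>z\<in>Z. cmod z / R)"
  define e where "e = (\<lambda>r::real. \<sigma> * R / r * (2 / pi + (1 - r\<^sup>2) / pi))"
  have "M \<ge> 0" using order_trans[OF norm_ge_zero assms(2)[of 0]] by simp
  have bound: "cmod (f 0) \<le> M * exp (e r) * P" if r: "0 < r" "r < 1" for r
  proof -
    \<comment> \<open>The circle of radius \<open>R\<close> is scaled to radius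
      \<open>r < 1\<close>, inside the domain of \<open>q\<close>. The added constant cancels the
      error term in the bound for \<open>q\<close>, and the factor \<open>\<sigma> * R / r\<close>
      undoes the scaling of \<open>Im z\<close>.\<close>
    define E where "E = (\<lambda>z. of_real (\<sigma> * R / r) * (q (of_real (r / R) * z) + of_real ((1 - r\<^sup>2) / pi)))"
    define S where "S = ball (0::complex) (R / r)"
    have sub: "cmod (of_real (r / R) * z) < 1" if "z \<in> S" for z
    proof -
      have "cmod (of_real (r / R) * z) = r * cmod z / R"
        using r \<open>R > 0\<close> unfolding norm_mult norm_of_real by simp
      also have "\<dots> < 1"
        using that r \<open>R > 0\<close> by (simp add: S_def field_simps)
      finally show ?thesis .
    qed
    have "R < R / r" using r \<open>R > 0\<close> by (simp add: field_simps)
    have "(q \<circ> (\<lambda>z. of_real (r / R) * z)) holomorphic_on S"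
      by (rule holomorphic_on_compose_gen[OF _ q(1)])
         (use sub in \<open>auto simp del: of_real_divide intro!: holomorphic_intros\<close>)
    then have holE: "E holomorphic_on S"
      unfolding E_def o_def by (intro holomorphic_intros) auto
    have "cmod (f 0 * exp (- E 0)) \<le> M * (\<Prod>z\<in>Z. cmod z / R)"
    proof (rule Jensen_zeros_bound)
      show "(\<lambda>z. f z * exp (- E z)) holomorphic_on S"
        using assms(1) holE by (intro holomorphic_intros) (auto intro: holomorphic_on_subset)
      show "cball 0 R \<subseteq> S" using \<open>R < R / r\<close> by (auto simp: S_def)
      fix z :: complex assume z: "cmod z = R"
      then have "z \<in> S" using \<open>R < R / r\<close> by (simp add: S_def)
      have "cmod (of_real (r / R) * z) = r"
        using z r \<open>R > 0\<close> unfolding norm_mult norm_of_real by simp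
      then have "Re (q (of_real (r / R) * z)) + (1 - r\<^sup>2) / pi \<ge> \<bar>Im (of_real (r / R) * z)\<bar>"
        using q(3)[OF sub[OF \<open>z \<in> S\<close>]] by simp
      also have "\<bar>Im (of_real (r / R) * z)\<bar> = r / R * \<bar>Im z\<bar>"
        using r \<open>R > 0\<close> by (simp add: abs_mult)
      finally have "(\<sigma> * R / r) * (r / R * \<bar>Im z\<bar>) \<le> (\<sigma> * R / r) * (Re (q (of_real (r / R) * z)) + (1 - r\<^sup>2) / pi)"
        using r \<open>R > 0\<close> \<open>\<sigma> \<ge> 0\<close> by (intro mult_left_mono) auto
      then have "\<sigma> * \<bar>Im z\<bar> \<le> Re (E z)"
        using r \<open>R > 0\<close> by (simp add: E_def)
      then have "cmod (f z) * exp (- Re (E z)) \<le> M * exp (\<sigma> * \<bar>Im z\<bar>) * exp (- (\<sigma> * \<bar>Im z\<bar>))"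
        using assms(2)[of z] \<open>M \<ge> 0\<close> by (intro mult_mono) auto
      also have "\<dots> = M" unfolding mult.assoc exp_add[symmetric] by simp
      finally show "cmod (f z * exp (- E z)) \<le> M"
        by (simp add: norm_mult)
    qed (use assms in \<open>auto simp: S_def\<close>)
    moreover have "Re (E 0) = e r"
      by (simp add: E_def e_def q(2))
    ultimately have "cmod (f 0) * exp (- e r) \<le> M * P"
      by (simp add: norm_mult P_def)
    then show ?thesis by (simp add: exp_minus field_simps)
  qed
  \<comment> \<open>Letting \<open>r\<close> tend to 1 removes the error term, since
    \<open>e 1 = 2 * \<sigma> * R / pi\<close>.\<close>
  have "((\<lambda>r. M * exp (e r) * P) \<longlongrightarrow> M * exp (e 1) * P) (at_left 1)"
    unfolding e_def by (intro tendsto_intros) auto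
  moreover have "eventually (\<lambda>r. cmod (f 0) \<le> M * exp (e r) * P) (at_left 1)"
    using eventually_at_left_real[OF zero_less_one] by eventually_elim (use bound in auto)
  ultimately have "cmod (f 0) \<le> M * exp (e 1) * P"
    by (intro tendsto_lowerbound) auto
  then show ?thesis by (simp add: e_def P_def mult_ac)
qed

section \<open>Analyticity and growth of \<open>\<G>\<close>\<close>

lemma set_integrable_mult_bounded:
  fixes u g :: "'a \<Rightarrow> complex"
  assumes "set_integrable M A u" "g \<in> borel_measurable M" "\<And>t. t \<in> A \<Longrightarrow> cmod (g t) \<le> B"
  shows "set_integrable M A (\<lambda>t. u t * g t)"
proof (rule set_integrable_bound)
  show "set_integrable M A (\<lambda>t. of_real B * u t)"
    using assms(1) by (rule set_integrable_mult_right)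
  have "(\<lambda>t. (indicator A t *\<^sub>R u t) * g t) \<in> borel_measurable M"
    using borel_measurable_integrable[OF assms(1)[unfolded set_integrable_def]] assms(2)
    by (rule borel_measurable_times)
  then show "set_borel_measurable M A (\<lambda>t. u t * g t)"
    by (simp add: set_borel_measurable_def)
  have "cmod (u t * g t) \<le> cmod (of_real B * u t)" if "t \<in> A" for t
  proof -
    have "cmod (g t) \<le> \<bar>B\<bar>" using assms(3)[OF that] by linarith
    then show ?thesis
      unfolding norm_mult by (simp add: mult.commute[of "cmod (u t)"] mult_right_mono)
  qed
  then show "AE t in M. t \<in> A \<longrightarrow> cmod (u t * g t) \<le> cmod (of_real B * u t)"
    by auto
qed

text \<open>The exponential kernel is expanded in its power series and integrated termwise; on the
  bounded interval the terms are dominated by \<open>(cmod z * T) ^ n / fact n\<close>.\<close>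

lemma \<G>_holomorphic:
  assumes "u absolutely_integrable_on {0<..<T}"
  shows "\<G> T u holomorphic_on UNIV"
proof -
  define A where "A = {0<..<T}"
  have u: "set_integrable lebesgue A u" using assms by (simp add: A_def)
  \<comment> \<open>These Taylor coefficients do not involve \<open>z\<close>, so a single series
    represents \<open>\<G>\<close> on every disc about the origin.\<close>
  define c where "c = (\<lambda>n. LINT t:A|lebesgue. u t * ((- \<i> * of_real t) ^ n / fact n))"
  have sums: "(\<lambda>n. c n * (z - 0) ^ n) sums \<G> T u z" for z
  proof -
    define f where "f = (\<lambda>n t. indicator A t *\<^sub>R (u t * ((- \<i> * z * of_real t) ^ n / fact n)))"
    have term_le: "cmod ((- \<i> * z * of_real t) ^ n / fact n) \<le> (cmod z * T) ^ n / fact n"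
      if "t \<in> A" for n t
      using that by (auto simp: norm_divide norm_power norm_mult A_def intro!: divide_right_mono power_mono mult_left_mono)
    have "set_integrable lebesgue A (\<lambda>t. u t * ((- \<i> * z * of_real t) ^ n / fact n))" for n
      using u _ term_le
      by (rule set_integrable_mult_bounded) (auto intro!: measurable_completion)
    then have int: "integrable lebesgue (f n)" for n
      by (simp add: f_def set_integrable_def)
    have fsums: "(\<lambda>n. f n t) sums (indicator A t *\<^sub>R (u t * exp (- \<i> * z * of_real t)))" for t
      unfolding f_def using exp_converges[of "- \<i> * z * of_real t"]
      by (intro sums_scaleR_right sums_mult) (simp add: scaleR_conv_of_real divide_inverse mult.commute)
    have norm_sum: "summable (\<lambda>n. cmod (f n t))" for t
    proof -
      have "summable (\<lambda>n. indicator A t * (cmod (u t) * (cmod (- \<i> * z * of_real t) ^ n / fact n)))"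
        by (intro summable_mult) (use summable_exp[of "cmod (- \<i> * z * of_real t)"] in \<open>simp add: divide_inverse mult.commute\<close>)
      then show ?thesis by (simp add: f_def norm_mult norm_power norm_divide)
    qed
    have int_sum: "summable (\<lambda>n. LINT t|lebesgue. cmod (f n t))"
    proof (rule summable_comparison_test')
      show "summable (\<lambda>n. (LINT t|lebesgue. cmod (indicator A t *\<^sub>R u t)) * ((cmod z * T) ^ n / fact n))"
        by (intro summable_mult) (use summable_exp[of "cmod z * T"] in \<open>simp add: divide_inverse mult.commute\<close>)
      fix n :: nat
      have "(LINT t|lebesgue. cmod (f n t)) \<le> (LINT t|lebesgue. cmod (indicator A t *\<^sub>R u t) * ((cmod z * T) ^ n / fact n))"
      proof (rule integral_mono)
        show "integrable lebesgue (\<lambda>t. cmod (indicator A t *\<^sub>R u t) * ((cmod z * T) ^ n / fact n))"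
          using u by (intro integrable_mult_left integrable_norm) (simp add: set_integrable_def)
        fix t
        show "cmod (f n t) \<le> cmod (indicator A t *\<^sub>R u t) * ((cmod z * T) ^ n / fact n)"
          using mult_left_mono[OF term_le, of t "cmod (u t)" n]
          by (cases "t \<in> A") (simp_all add: f_def norm_mult norm_divide)
      qed (use int in \<open>auto intro: integrable_norm\<close>)
      then show "norm (LINT t|lebesgue. cmod (f n t)) \<le> (LINT t|lebesgue. cmod (indicator A t *\<^sub>R u t)) * ((cmod z * T) ^ n / fact n)"
        by (simp add: integral_nonneg_AE)
    qed
    have "(\<lambda>n. integral\<^sup>L lebesgue (f n)) sums (LINT t|lebesgue. (\<Sum>n. f n t))"
      using int norm_sum int_sum by (intro sums_integral) auto
    also have "(\<lambda>t. \<Sum>n. f n t) = (\<lambda>t. indicator A t *\<^sub>R (u t * exp (- \<i> * z * of_real t)))"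
      using fsums by (auto simp: sums_iff)
    also have "(LINT t|lebesgue. indicator A t *\<^sub>R (u t * exp (- \<i> * z * of_real t))) = \<G> T u z"
      by (simp add: \<G>_def A_def set_lebesgue_integral_def)
    also have "(\<lambda>n. integral\<^sup>L lebesgue (f n)) = (\<lambda>n. c n * (z - 0) ^ n)"
    proof
      fix n
      have "c n * (z - 0) ^ n = (LINT t:A|lebesgue. u t * ((- \<i> * of_real t) ^ n / fact n) * z ^ n)"
        unfolding c_def by simp
      also have "\<dots> = integral\<^sup>L lebesgue (f n)"
        unfolding f_def set_lebesgue_integral_def
        by (intro Bochner_Integration.integral_cong refl) (simp add: power_mult_distrib power_minus' mult_ac)
      finally show "integral\<^sup>L lebesgue (f n) = c n * (z - 0) ^ n" ..
    qed
    finally show ?thesis .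
  qed
  show ?thesis
    unfolding holomorphic_on_def
  proof
    fix z :: complex
    have "\<G> T u holomorphic_on ball 0 (cmod z + 1)"
      using sums by (intro power_series_holomorphic) auto
    then have "\<G> T u field_differentiable at z"
      by (rule holomorphic_on_imp_differentiable_at) auto
    then show "\<G> T u field_differentiable at z within UNIV" by simp
  qed
qed

text \<open>The kernel has modulus \<open>exp (t * Im z)\<close>, and \<open>t * Im z\<close> is at
  most \<open>T\<close> times the positive part of \<open>Im z\<close>. Writing that part as half of
  \<open>Im z + \<bar>Im z\<bar>\<close> prepares the cancellation against
  \<open>exp (\<i> * z * T / 2)\<close>.\<close>

lemma norm_\<G>_le:
  assumes "u absolutely_integrable_on {0<..<T}"
  shows "cmod (\<G> T u z) \<le> L1_norm T u * exp (T / 2 * Im z + T / 2 * \<bar>Im z\<bar>)"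
proof -
  let ?K = "exp (T / 2 * Im z + T / 2 * \<bar>Im z\<bar>)"
  have le: "cmod (exp (- \<i> * z * of_real t)) \<le> ?K" if "t \<in> {0<..<T}" for t
  proof -
    have "Im z * t \<le> T / 2 * Im z + T / 2 * \<bar>Im z\<bar>"
      using that by (cases "Im z \<ge> 0") (auto simp: mult.commute[of _ t] mult_right_mono mult_nonneg_nonpos)
    then show ?thesis by simp
  qed
  have "set_integrable lebesgue {0<..<T} (\<lambda>t. u t * exp (- \<i> * z * of_real t))"
    using assms _ le by (rule set_integrable_mult_bounded) (auto intro!: measurable_completion)
  then have "cmod (\<G> T u z) \<le> (LINT t:{0<..<T}|lebesgue. cmod (u t * exp (- \<i> * z * of_real t)))"
    unfolding \<G>_def by (rule set_integral_norm_bound)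
  also have "\<dots> \<le> (LINT t:{0<..<T}|lebesgue. cmod (u t) * ?K)"
  proof (rule set_integral_mono)
    fix t assume "t \<in> {0<..<T}"
    from mult_left_mono[OF le[OF this] norm_ge_zero[of "u t"]]
    show "cmod (u t * exp (- \<i> * z * of_real t)) \<le> cmod (u t) * ?K"
      by (simp add: norm_mult)
  next
    show "set_integrable lebesgue {0<..<T} (\<lambda>t. cmod (u t * exp (- \<i> * z * of_real t)))"
      by (rule set_integrable_norm) fact
    show "set_integrable lebesgue {0<..<T} (\<lambda>t. cmod (u t) * ?K)"
      using assms by (intro set_integrable_mult_left set_integrable_norm)
  qed
  also have "\<dots> = L1_norm T u * ?K" by (simp add: L1_norm_def)
  finally show ?thesis .
qed

section \<open>Jensen's inequality for \<open>\<G>\<close>\<close>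

lemma L1_norm_Jensen:
  fixes lam :: "nat \<Rightarrow> real"
  assumes u: "u absolutely_integrable_on {0<..<T}" and "T > 0" "R > 0"
    and one: "\<G> T u (- of_real (lam 1)) = 1"
    and zero: "\<And>k. k \<in> {2..N} \<Longrightarrow> \<G> T u (- of_real (lam k)) = 0"
    and R: "\<And>k. k \<in> {2..N} \<Longrightarrow> \<bar>lam k - lam 1\<bar> < R"
    and inj: "inj_on lam {1..}"
  shows "1 \<le> L1_norm T u * exp (T * R / pi) * (\<Prod>k\<in>{2..N}. \<bar>lam k - lam 1\<bar> / R)"
proof -
  \<comment> \<open>The exponential factor moves the midpoint of the interval to 0, which makes the
    growth symmetric with type \<open>T / 2\<close>.\<close>
  define f where "f = (\<lambda>z. \<G> T u (z - of_real (lam 1)) * exp (\<i> * z * of_real (T / 2)))"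
  define \<zeta> where "\<zeta> = (\<lambda>k. complex_of_real (lam 1 - lam k))"
  have ne: "lam 1 \<noteq> lam k" if "k \<in> {2..N}" for k
    using inj_onD[OF inj, of 1 k] that by auto
  have inj': "inj_on \<zeta> {2..N}"
    using inj by (auto simp: \<zeta>_def inj_on_def)
  have "cmod (f 0) \<le> L1_norm T u * exp (2 * (T / 2) * R / pi) * (\<Prod>z\<in>\<zeta> ` {2..N}. cmod z / R)"
  proof (rule Jensen_exponential_type)
    have "(\<G> T u \<circ> (\<lambda>z. z - of_real (lam 1))) holomorphic_on UNIV"
      by (rule holomorphic_on_compose_gen[OF _ \<G>_holomorphic[OF u]]) (auto intro!: holomorphic_intros)
    then show "f holomorphic_on UNIV"
      unfolding f_def o_def by (intro holomorphic_intros) auto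
    fix z
    have "cmod (f z) = cmod (\<G> T u (z - of_real (lam 1))) * exp (- (T / 2 * Im z))"
      by (simp add: f_def norm_mult)
    also have "\<dots> \<le> L1_norm T u * exp (T / 2 * Im z + T / 2 * \<bar>Im z\<bar>) * exp (- (T / 2 * Im z))"
      using norm_\<G>_le[OF u, of "z - of_real (lam 1)"] by (intro mult_right_mono) auto
    also have "\<dots> = L1_norm T u * exp (T / 2 * \<bar>Im z\<bar>)"
      unfolding mult.assoc exp_add[symmetric] by simp
    finally show "cmod (f z) \<le> L1_norm T u * exp (T / 2 * \<bar>Im z\<bar>)" .
  next
    show "\<zeta> ` {2..N} \<subseteq> ball 0 R"
      using R by (auto simp: \<zeta>_def abs_minus_commute simp del: of_real_diff)
    fix z assume "z \<in> \<zeta> ` {2..N}"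
    then show "f z = 0" using zero by (auto simp: f_def \<zeta>_def)
  next
    show "0 \<notin> \<zeta> ` {2..N}" using ne by (fastforce simp: \<zeta>_def)
  qed (use assms in auto)
  moreover have "(\<Prod>z\<in>\<zeta> ` {2..N}. cmod z / R) = (\<Prod>k\<in>{2..N}. \<bar>lam k - lam 1\<bar> / R)"
    by (subst prod.reindex[OF inj']) (simp add: \<zeta>_def abs_minus_commute del: of_real_diff)
  moreover have "f 0 = 1" using one by (simp add: f_def)
  ultimately show ?thesis by simp
qed

section \<open>The logarithmic sum and bounds on the sequence\<close>

text \<open>A Stirling-type bound by induction. With \<open>y = N + D\<close>, the new term is
  \<open>ln 1 = 0\<close> and each of the \<open>N - 1\<close> old ones gains
  \<open>l = ln ((y + 1) / y)\<close>. As \<open>N - 1 = (y + 1) - (2 + D)\<close>, the part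
  \<open>(y + 1) * l \<ge> 1\<close> pays for the main term and the rest for the logarithm.\<close>

lemma sum_ln_ratio_ge:
  fixes D :: real
  assumes "D \<ge> 0" "N \<ge> 1"
  shows "(\<Sum>k\<in>{2..N}. ln ((real N + D) / (real k + D)))
    \<ge> (real N + D) - (2 + D) * (1 + ln (real N + D))"
  using \<open>N \<ge> 1\<close>
proof (induction N rule: nat_induct_at_least)
  case base
  have "ln (1 + D) \<ge> 0" using assms by simp
  then have "(2 + D) * (1 + ln (1 + D)) \<ge> (2 + D) * 1"
    using assms by (intro mult_left_mono) auto
  then show ?case by simp
next
  case (Suc N)
  define y where "y = real N + D"
  have y: "y \<ge> 1" "real N - 1 = (y + 1) - (2 + D)" using Suc assms by (auto simp: y_def)
  define l where "l = ln ((y + 1) / y)"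
  have l_eq: "l = ln (y + 1) - ln y" using y by (simp add: l_def ln_div)
  have "ln (y / (y + 1)) \<le> y / (y + 1) - 1" using y by (intro ln_le_minus_one) auto
  then have "(y + 1) * l \<ge> 1" using y by (simp add: l_eq ln_div field_simps)
  have "(\<Sum>k\<in>{2..Suc N}. ln ((real (Suc N) + D) / (real k + D)))
      = (\<Sum>k\<in>{2..N}. ln ((y + 1) / (real k + D)))"
    using Suc.hyps assms by (simp add: y_def add_ac)
  also have "\<dots> = (\<Sum>k\<in>{2..N}. l + ln (y / (real k + D)))"
    using y assms by (intro sum.cong) (auto simp: l_eq ln_div)
  also have "\<dots> = (real N - 1) * l + (\<Sum>k\<in>{2..N}. ln (y / (real k + D)))"
    using Suc.hyps by (simp add: sum.distrib of_nat_diff)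
  also have "\<dots> \<ge> ((y + 1) - (2 + D)) * l + (y - (2 + D) * (1 + ln y))"
    using Suc.IH y by (simp add: y_def)
  finally have "(\<Sum>k\<in>{2..Suc N}. ln ((real (Suc N) + D) / (real k + D)))
      \<ge> (y + 1) * l - (2 + D) * l + (y - (2 + D) * (1 + ln y))"
    by (simp add: algebra_simps)
  moreover have "(y + 1) * l - (2 + D) * l + (y - (2 + D) * (1 + ln y))
     = (y + 1) * l + y - (2 + D) * (1 + ln (y + 1))"
    by (simp add: l_eq algebra_simps)
  ultimately show ?case using \<open>(y + 1) * l \<ge> 1\<close> by (simp add: y_def add_ac)
qed

text \<open>The form in which the gap enters the zero count.\<close>

lemma inj_on_if_gap_pos:
  assumes "gap lam > 0"
  shows "inj_on lam {1..}"
proof (rule inj_onI, rule ccontr)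
  fix k n :: nat assume kn: "k \<in> {1..}" "n \<in> {1..}" "lam k = lam n" "k \<noteq> n"
  have "gap lam \<le> (case (k, n) of (k, n) \<Rightarrow> \<bar>lam k - lam n\<bar>)"
    unfolding gap_def by (rule cINF_lower) (use kn in \<open>auto intro!: bdd_belowI[of _ 0]\<close>)
  then show False using assms kn by simp
qed

text \<open>The deviation is absorbed into a shift of the index: factor out
  \<open>k powr (\<alpha> - 1)\<close>, then enlarge its base to
  \<open>k + \<bar>G\<bar> / a\<close>.\<close>

lemma lam_le_if_dev_le:
  fixes \<alpha> a G :: real
  assumes "dev \<alpha> a lam \<le> ereal G" "\<alpha> > 1" "a > 0" "k \<ge> 1"
  shows "lam k \<le> a * (real k + \<bar>G\<bar> / a) powr \<alpha>"
proof -
  have "ereal (\<bar>lam k - a * real k powr \<alpha>\<bar> / real k powr (\<alpha> - 1)) \<le> dev \<alpha> a lam"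
    unfolding dev_def using \<open>k \<ge> 1\<close> by (intro SUP_upper) auto
  also note assms(1)
  finally have "\<bar>lam k - a * real k powr \<alpha>\<bar> \<le> G * real k powr (\<alpha> - 1)"
    using \<open>k \<ge> 1\<close> by (simp add: divide_le_eq)
  also have "\<dots> \<le> \<bar>G\<bar> * real k powr (\<alpha> - 1)"
    by (intro mult_right_mono) auto
  finally have "lam k \<le> a * real k powr \<alpha> + \<bar>G\<bar> * real k powr (\<alpha> - 1)"
    by linarith
  also have "real k powr \<alpha> = real k powr (\<alpha> - 1) * real k"
    using \<open>k \<ge> 1\<close> by (simp add: powr_diff)
  also have "a * (real k powr (\<alpha> - 1) * real k) + \<bar>G\<bar> * real k powr (\<alpha> - 1)
      = a * (real k powr (\<alpha> - 1) * (real k + \<bar>G\<bar> / a))"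
    using \<open>a > 0\<close> by (simp add: field_simps)
  also have "\<dots> \<le> a * ((real k + \<bar>G\<bar> / a) powr (\<alpha> - 1) * (real k + \<bar>G\<bar> / a))"
    using assms by (intro mult_left_mono mult_right_mono powr_mono2) auto
  also have "(real k + \<bar>G\<bar> / a) powr (\<alpha> - 1) * (real k + \<bar>G\<bar> / a) = (real k + \<bar>G\<bar> / a) powr \<alpha>"
    using powr_add[of "real k + \<bar>G\<bar> / a" "\<alpha> - 1" 1] assms by simp
  finally show ?thesis .
qed

section \<open>Lower bounds for the norm and choice of the radius\<close>

lemma L1_norm_ge_one:
  assumes "u absolutely_integrable_on {0<..<T}" "\<G> T u (of_real x) = 1"
  shows "L1_norm T u \<ge> 1"
  using norm_\<G>_le[OF assms(1), of "of_real x"] assms(2) by simp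

text \<open>With radius \<open>a * X powr \<alpha>\<close>, the upper bound for
  \<open>lam N\<close>, each zero contributes a factor at most
  \<open>((k + D) / X) powr \<alpha>\<close>, so the product is governed by the logarithmic sum.
  \<open>N\<close> stays free for the later optimisation.\<close>

lemma L1_norm_ge_exp:
  fixes lam :: "nat \<Rightarrow> real" and \<alpha> a D :: real
  assumes u: "u absolutely_integrable_on {0<..<T}" and "T > 0" "\<alpha> > 1" "a > 0" "D \<ge> 0"
    and one: "\<G> T u (- of_real (lam 1)) = 1"
    and zero: "\<And>k. k \<ge> 2 \<Longrightarrow> \<G> T u (- of_real (lam k)) = 0"
    and pos: "\<And>k. k \<ge> 1 \<Longrightarrow> lam k > 0"
    and le: "\<And>k. k \<ge> 1 \<Longrightarrow> lam k \<le> a * (real k + D) powr \<alpha>"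
    and inj: "inj_on lam {1..}"
    and "N \<ge> 1"
  defines "X \<equiv> real N + D"
  shows "L1_norm T u \<ge> exp (\<alpha> * (X - (2 + D) * (1 + ln X)) - T * a / pi * X powr \<alpha>)"
proof -
  define R where "R = a * X powr \<alpha>"
  define S where "S = (\<Sum>k\<in>{2..N}. ln (X / (real k + D)))"
  have X: "X \<ge> 1" using assms by (simp add: X_def)
  have "R > 0" using X \<open>a > 0\<close> by (simp add: R_def)
  \<comment> \<open>Both values are positive and obey the same upper bound, hence the strict
    inequality.\<close>
  have less: "\<bar>lam k - lam 1\<bar> < a * (real k + D) powr \<alpha>" if "k \<ge> 1" for k
  proof -
    have "lam 1 \<le> a * (real 1 + D) powr \<alpha>" by (rule le) simp
    also have "\<dots> \<le> a * (real k + D) powr \<alpha>"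
      using assms that by (intro mult_left_mono powr_mono2) auto
    finally show ?thesis using le[OF that] pos[OF that] pos[of 1] by linarith
  qed
  have le_R: "a * (real k + D) powr \<alpha> \<le> R" if "k \<in> {2..N}" for k
    using that assms by (auto simp: R_def X_def intro!: mult_left_mono powr_mono2)
  have "(\<Prod>k\<in>{2..N}. \<bar>lam k - lam 1\<bar> / R) \<le> (\<Prod>k\<in>{2..N}. exp (- (\<alpha> * ln (X / (real k + D)))))"
  proof (intro prod_mono conjI)
    fix k assume k: "k \<in> {2..N}"
    have "\<bar>lam k - lam 1\<bar> / R \<le> a * (real k + D) powr \<alpha> / R"
      using less[of k] k \<open>R > 0\<close> by (intro divide_right_mono) auto
    also have "\<dots> = (real k + D) powr \<alpha> / X powr \<alpha>"
      using \<open>a > 0\<close> by (simp add: R_def)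
    also have "\<dots> = exp (- (\<alpha> * ln (X / (real k + D))))"
      using X k \<open>D \<ge> 0\<close> by (simp add: powr_def ln_div right_diff_distrib flip: exp_diff)
    finally show "\<bar>lam k - lam 1\<bar> / R \<le> exp (- (\<alpha> * ln (X / (real k + D))))" .
  qed (use \<open>R > 0\<close> in auto)
  also have "\<dots> = exp (- (\<alpha> * S))"
    by (simp add: S_def exp_sum sum_distrib_left flip: sum_negf)
  finally have prod: "(\<Prod>k\<in>{2..N}. \<bar>lam k - lam 1\<bar> / R) \<le> exp (- (\<alpha> * S))" .
  have L1: "L1_norm T u \<ge> 1"
    using L1_norm_ge_one[OF u, of "- lam 1"] one by simp
  have "1 \<le> L1_norm T u * exp (T * R / pi) * (\<Prod>k\<in>{2..N}. \<bar>lam k - lam 1\<bar> / R)"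
  proof (rule L1_norm_Jensen[OF u \<open>T > 0\<close> \<open>R > 0\<close> one _ _ inj])
    show "\<bar>lam k - lam 1\<bar> < R" if "k \<in> {2..N}" for k
      using less[of k] le_R[OF that] that by force
  qed (use zero in auto)
  also have "\<dots> \<le> L1_norm T u * exp (T * R / pi) * exp (- (\<alpha> * S))"
    using prod L1 by (intro mult_left_mono) auto
  finally have "exp (\<alpha> * S) / exp (T * R / pi) \<le> L1_norm T u"
    by (simp only: exp_minus) (simp add: field_simps)
  then have "exp (\<alpha> * S - T * R / pi) \<le> L1_norm T u"
    by (simp only: exp_diff)
  moreover have "\<alpha> * S \<ge> \<alpha> * (X - (2 + D) * (1 + ln X))"
    using sum_ln_ratio_ge[OF \<open>D \<ge> 0\<close> \<open>N \<ge> 1\<close>] \<open>\<alpha> > 1\<close>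
    by (intro mult_left_mono) (auto simp: S_def X_def)
  then have "exp (\<alpha> * (X - (2 + D) * (1 + ln X)) - T * a / pi * X powr \<alpha>) \<le> exp (\<alpha> * S - T * R / pi)"
    by (simp add: R_def mult.assoc)
  ultimately show ?thesis by linarith
qed

theorem lemma2p2:
  fixes \<alpha> a \<gamma> \<Gamma>\<^sub>1 m :: real
  assumes "\<alpha> > 1" and "a > 0" and "\<gamma> > 0" and "m > 0"
  shows "\<exists>c>0. \<exists>C>0. \<forall>(lam :: nat \<Rightarrow> real) (T :: real) (u :: real \<Rightarrow> complex).
    (\<forall>k\<ge>1. lam k > 0) \<and> gap lam = \<gamma> \<and> dev \<alpha> a lam = ereal \<Gamma>\<^sub>1 \<and>
    0 < T \<and> T < m \<and> u absolutely_integrable_on {0<..<T} \<and>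
    \<G> T u (- complex_of_real (lam 1)) = 1 \<and>
    (\<forall>k\<ge>2. \<G> T u (- complex_of_real (lam k)) = 0)
    \<longrightarrow> L1_norm T u \<ge> c * T powr C * exp (\<rho> \<alpha> a / T powr (1 / (\<alpha> - 1)))"
proof -
  define \<tau> where "\<tau> = 1 / (\<alpha> - 1)"
  define D where "D = \<bar>\<Gamma>\<^sub>1\<bar> / a"
  \<comment> \<open>Since \<open>Y\<close> below is a constant times
    \<open>T powr (- \<tau>)\<close>, the loss \<open>\<alpha> * (2 + D) * ln Y\<close> becomes the
    power \<open>T powr C\<close>.\<close>
  define C where "C = \<tau> * (\<alpha> * (2 + D))"
  \<comment> \<open>\<open>c1\<close> serves small \<open>T\<close>: its \<open>- \<alpha>\<close>
    pays for rounding \<open>Y\<close> down by at most 1. \<open>c2\<close> makes the claimed bound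
    at most 1 when \<open>Y < D + 1\<close>.\<close>
  define c1 where "c1 = exp (- \<alpha> - \<alpha> * (2 + D)) * (a / pi) powr C"
  define c2 where "c2 = exp (- ((\<alpha> - 1) * (D + 1))) / m powr C"
  have \<tau>: "\<tau> > 0" and D: "D \<ge> 0" using assms by (auto simp: \<tau>_def D_def)
  have C: "C > 0" using \<tau> D assms by (simp add: C_def)
  have c: "c1 > 0" "c2 > 0" using assms by (auto simp: c1_def c2_def)
  have "min c1 c2 * T powr C * exp (\<rho> \<alpha> a / T powr \<tau>) \<le> L1_norm T u"
    if pos: "\<forall>k\<ge>1. lam k > 0" and gap: "gap lam = \<gamma>" and dev: "dev \<alpha> a lam = ereal \<Gamma>\<^sub>1"
      and T: "0 < T" "T < m" and u: "u absolutely_integrable_on {0<..<T}"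
      and one: "\<G> T u (- complex_of_real (lam 1)) = 1"
      and zero: "\<forall>k\<ge>2. \<G> T u (- complex_of_real (lam k)) = 0"
    for lam :: "nat \<Rightarrow> real" and T :: real and u :: "real \<Rightarrow> complex"
  proof -
    \<comment> \<open>the maximiser of \<open>\<alpha> * X - T * a / pi * X powr \<alpha>\<close>\<close>
    define Y where "Y = (pi / (a * T)) powr \<tau>"
    have Y: "Y > 0" using assms T by (simp add: Y_def)
    have "Y = (pi / a) powr \<tau> / T powr \<tau>"
      using assms T by (simp add: Y_def powr_divide powr_mult)
    then have \<rho>: "\<rho> \<alpha> a / T powr \<tau> \<le> (\<alpha> - 1) * Y"
      using \<rho>_le[OF assms(1,2)] T by (simp add: \<tau>_def divide_right_mono)
    show ?thesis
    proof (cases "Y < D + 1")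
      \<comment> \<open>No \<open>N \<ge> 1\<close> satisfies \<open>N + D \<le> Y\<close> here, but
        \<open>Y\<close> is bounded and the trivial bound 1 on the norm suffices.\<close>
      case True
      have "min c1 c2 * T powr C * exp (\<rho> \<alpha> a / T powr \<tau>) \<le> c2 * m powr C * exp ((\<alpha> - 1) * (D + 1))"
      proof (intro mult_mono)
        have "(\<alpha> - 1) * Y \<le> (\<alpha> - 1) * (D + 1)"
          using True assms by (intro mult_left_mono) auto
        then show "exp (\<rho> \<alpha> a / T powr \<tau>) \<le> exp ((\<alpha> - 1) * (D + 1))"
          using \<rho> by simp
        show "T powr C \<le> m powr C" using T C by (intro powr_mono2) auto
      qed (use c in auto)
      also have "\<dots> = 1" using assms by (simp add: c2_def exp_minus)
      also have "1 \<le> L1_norm T u" using L1_norm_ge_one[OF u, of "- lam 1"] one by simp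
      finally show ?thesis .
    next
      case False
      define N where "N = nat \<lfloor>Y - D\<rfloor>"
      define X where "X = real N + D"
      have "\<lfloor>Y - D\<rfloor> \<ge> 1" using False by simp
      then have N: "N \<ge> 1" "real N = of_int \<lfloor>Y - D\<rfloor>" unfolding N_def by linarith+
      then have X: "1 \<le> X" "X \<le> Y" "Y - 1 \<le> X" using D by (simp_all add: X_def) linarith+
      have "ln Y = \<tau> * ln (pi / (a * T))"
        using assms T by (simp add: Y_def ln_powr)
      then have lnY: "\<alpha> * ((2 + D) * ln Y) = C * ln (pi / (a * T))"
        by (simp add: C_def)
      have "Y powr \<alpha> = Y * Y powr (\<alpha> - 1)" using Y by (simp add: powr_diff)
      also have "Y powr (\<alpha> - 1) = pi / (a * T)"
        using assms T by (simp add: Y_def \<tau>_def powr_powr)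
      \<comment> \<open>Hence the maximum is \<open>\<alpha> * Y - Y\<close>, which matches the
        bound on \<open>\<rho>\<close>.\<close>
      finally have powY: "T * a / pi * Y powr \<alpha> = Y" using assms T by simp
      have "(a / pi) powr C * T powr C = (a * T / pi) powr C"
        using assms T by (simp flip: powr_mult)
      also have "\<dots> = exp (- (C * ln (pi / (a * T))))"
        using assms T by (simp add: powr_def ln_div ln_mult algebra_simps)
      finally have aT: "(a / pi) powr C * T powr C = exp (- (\<alpha> * ((2 + D) * ln Y)))"
        by (simp add: lnY)
      have "min c1 c2 * T powr C * exp (\<rho> \<alpha> a / T powr \<tau>) \<le> c1 * T powr C * exp ((\<alpha> - 1) * Y)"
        using c \<rho> by (intro mult_mono) auto
      also have "\<dots> = exp (- \<alpha> - \<alpha> * (2 + D)) * ((a / pi) powr C * T powr C) * exp ((\<alpha> - 1) * Y)"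
        by (simp add: c1_def)
      also have "\<dots> = exp (\<alpha> * ((Y - 1) - (2 + D) * (1 + ln Y)) - Y)"
        unfolding aT exp_add[symmetric] by (simp add: algebra_simps)
      \<comment> \<open>\<open>X \<ge> Y - 1\<close> is used in the linear term,
        \<open>X \<le> Y\<close> in the logarithm and the power.\<close>
      also have "\<dots> \<le> exp (\<alpha> * (X - (2 + D) * (1 + ln X)) - T * a / pi * X powr \<alpha>)"
      proof -
        have "T * a / pi * X powr \<alpha> \<le> T * a / pi * Y powr \<alpha>"
          using X assms T by (intro mult_left_mono powr_mono2) auto
        moreover have "(2 + D) * (1 + ln X) \<le> (2 + D) * (1 + ln Y)"
          using X D by (intro mult_left_mono) auto
        then have "\<alpha> * ((Y - 1) - (2 + D) * (1 + ln Y)) \<le> \<alpha> * (X - (2 + D) * (1 + ln X))"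
          using X assms by (intro mult_left_mono) auto
        ultimately show ?thesis using powY by simp
      qed
      also have "\<dots> \<le> L1_norm T u"
        unfolding X_def
      proof (rule L1_norm_ge_exp[where lam = lam, OF u T(1) assms(1,2) D one])
        show "inj_on lam {1..}" using gap assms by (intro inj_on_if_gap_pos) simp
        show "lam k \<le> a * (real k + D) powr \<alpha>" if "k \<ge> 1" for k
          unfolding D_def using that assms dev by (intro lam_le_if_dev_le) auto
      qed (use pos zero N in auto)
      finally show ?thesis .
    qed
  qed
  then show ?thesis
    unfolding \<tau>_def using C c by (intro exI[of _ "min c1 c2"] exI[of _ C] conjI) auto
qed

end
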